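(* Suppose that $T$ is a countable first order theory which has the strict order property, $\lambda$ is an infinite cardinal, and $T$ has a universal model (with respect to elementary embeddings) in cardinality $\lambda$. Then there exists a universal linear order in cardinality $\lambda$.
   Context: A formula $\varphi(\bar x;\bar y)$ has the strict order property if for every $n$ there are $\bar a_l$ ($l<n$) (in a model of $T$) such that for any $k,l<n$: $\models(\exists\bar x)[\neg\varphi(\bar x;\bar a_k)\wedge\varphi(\bar x;\bar a_l)]\Leftrightarrow k<l$. $T$ has the strict order property if some formula $\varphi(\bar x;\bar y)$ has it. A universal model of $T$ with respect to elementary embeddings in cardinality $\lambda$ is a model of $T$ of cardinality $\lambda$ into which every model of $T$ of cardinality at most $\lambda$ embeds elementarily. A universal linear order in cardinality $\lambda$ is a linear order of cardinality $\lambda$ into which every linear order of cardinality at most $\lambda$ embeds by an order-preserving one-to-one map. *)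

theory Defs
  imports Main "HOL-Library.Countable_Set"
begin

unbundle cardinal_syntax

(* Symbols are restricted to sets, rather than ranging over whole types, because HOL types are
   nonempty and a vocabulary may have no function symbols or no relation symbols. *)
record ('f, 'r) signature =
  funs :: "'f set"
  rels :: "'r set"
  fun_arity :: "'f \<Rightarrow> nat"
  rel_arity :: "'r \<Rightarrow> nat"

definition countable_signature :: "('f, 'r) signature \<Rightarrow> bool" where
  "countable_signature L \<longleftrightarrow> countable (funs L) \<and> countable (rels L)"

datatype 'f trm = Var nat | Fn 'f "'f trm list"

datatype ('f, 'r) fml =
    Eq "'f trm" "'f trm"
  | Rel 'r "'f trm list"
  | Neg "('f, 'r) fml"
  | Conj "('f, 'r) fml" "('f, 'r) fml"
  | Exists nat "('f, 'r) fml"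

primrec trm_vars :: "'f trm \<Rightarrow> nat set" where
  "trm_vars (Var v) = {v}"
| "trm_vars (Fn f ts) = \<Union> (set (map trm_vars ts))"

primrec free_vars :: "('f, 'r) fml \<Rightarrow> nat set" where
  "free_vars (Eq s t) = trm_vars s \<union> trm_vars t"
| "free_vars (Rel r ts) = (\<Union>t\<in>set ts. trm_vars t)"
| "free_vars (Neg \<phi>) = free_vars \<phi>"
| "free_vars (Conj \<phi> \<psi>) = free_vars \<phi> \<union> free_vars \<psi>"
| "free_vars (Exists v \<phi>) = free_vars \<phi> - {v}"

primrec is_term :: "('f, 'r) signature \<Rightarrow> 'f trm \<Rightarrow> bool" where
  "is_term L (Var v) \<longleftrightarrow> True"
| "is_term L (Fn f ts) \<longleftrightarrow> f \<in> funs L \<and> length ts = fun_arity L f \<and> list_all (is_term L) ts"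

primrec is_formula :: "('f, 'r) signature \<Rightarrow> ('f, 'r) fml \<Rightarrow> bool" where
  "is_formula L (Eq s t) \<longleftrightarrow> is_term L s \<and> is_term L t"
| "is_formula L (Rel r ts) \<longleftrightarrow> r \<in> rels L \<and> length ts = rel_arity L r \<and> list_all (is_term L) ts"
| "is_formula L (Neg \<phi>) \<longleftrightarrow> is_formula L \<phi>"
| "is_formula L (Conj \<phi> \<psi>) \<longleftrightarrow> is_formula L \<phi> \<and> is_formula L \<psi>"
| "is_formula L (Exists v \<phi>) \<longleftrightarrow> is_formula L \<phi>"

definition is_theory :: "('f, 'r) signature \<Rightarrow> ('f, 'r) fml set \<Rightarrow> bool" where
  "is_theory L T \<longleftrightarrow> (\<forall>\<phi>\<in>T. is_formula L \<phi> \<and> free_vars \<phi> = {})"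

record ('f, 'r, 'u) struct =
  dom_of :: "'u set"
  fun_int :: "'f \<Rightarrow> 'u list \<Rightarrow> 'u"
  rel_int :: "'r \<Rightarrow> 'u list \<Rightarrow> bool"

definition is_structure :: "('f, 'r) signature \<Rightarrow> ('f, 'r, 'u) struct \<Rightarrow> bool" where
  "is_structure L M \<longleftrightarrow> dom_of M \<noteq> {} \<and>
     (\<forall>f\<in>funs L. \<forall>as. length as = fun_arity L f \<and> set as \<subseteq> dom_of M \<longrightarrow> fun_int M f as \<in> dom_of M)"

primrec trm_val :: "('f, 'r, 'u) struct \<Rightarrow> (nat \<Rightarrow> 'u) \<Rightarrow> 'f trm \<Rightarrow> 'u" where
  "trm_val M e (Var v) = e v"
| "trm_val M e (Fn f ts) = fun_int M f (map (trm_val M e) ts)"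

primrec sat :: "('f, 'r, 'u) struct \<Rightarrow> (nat \<Rightarrow> 'u) \<Rightarrow> ('f, 'r) fml \<Rightarrow> bool" where
  "sat M e (Eq s t) \<longleftrightarrow> trm_val M e s = trm_val M e t"
| "sat M e (Rel r ts) \<longleftrightarrow> rel_int M r (map (trm_val M e) ts)"
| "sat M e (Neg \<phi>) \<longleftrightarrow> \<not> sat M e \<phi>"
| "sat M e (Conj \<phi> \<psi>) \<longleftrightarrow> sat M e \<phi> \<and> sat M e \<psi>"
| "sat M e (Exists v \<phi>) \<longleftrightarrow> (\<exists>a\<in>dom_of M. sat M (e(v := a)) \<phi>)"

definition is_model :: "('f, 'r) signature \<Rightarrow> ('f, 'r) fml set \<Rightarrow> ('f, 'r, 'u) struct \<Rightarrow> bool" where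
  "is_model L T M \<longleftrightarrow> is_structure L M \<and>
     (\<forall>\<phi>\<in>T. \<forall>e. range e \<subseteq> dom_of M \<longrightarrow> sat M e \<phi>)"

(* The value outside the listed variables is arbitrary; it is only used for formulas all of whose
   free variables are listed. *)
definition assign :: "nat list \<Rightarrow> 'u list \<Rightarrow> nat \<Rightarrow> 'u" where
  "assign vs as = (\<lambda>v. the (map_of (zip vs as) v))"

definition tuples :: "('f, 'r, 'u) struct \<Rightarrow> nat \<Rightarrow> 'u list set" where
  "tuples M n = {as. length as = n \<and> set as \<subseteq> dom_of M}"

(* The partition of the variables of a formula phi(xs; ys) is given by the two tuples of
   variables.  The type argument says where the models live; see the remark on cardinals below. *)
definition formula_has_SOP ::
  "'u itself \<Rightarrow> ('f, 'r) signature \<Rightarrow> ('f, 'r) fml set \<Rightarrow> ('f, 'r) fml \<Rightarrow> nat list \<Rightarrow> nat list \<Rightarrow> bool"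
where
  "formula_has_SOP U L T \<phi> xs ys \<longleftrightarrow>
     is_formula L \<phi> \<and> distinct (xs @ ys) \<and> free_vars \<phi> \<subseteq> set (xs @ ys) \<and>
     (\<forall>n::nat. \<exists>(M :: ('f, 'r, 'u) struct) a.
        is_model L T M \<and> (\<forall>l<n. a l \<in> tuples M (length ys)) \<and>
        (\<forall>k<n. \<forall>l<n.
           (\<exists>b\<in>tuples M (length xs).
              \<not> sat M (assign (xs @ ys) (b @ a k)) \<phi> \<and> sat M (assign (xs @ ys) (b @ a l)) \<phi>)
           \<longleftrightarrow> k < l))"

definition has_SOP :: "'u itself \<Rightarrow> ('f, 'r) signature \<Rightarrow> ('f, 'r) fml set \<Rightarrow> bool" where
  "has_SOP U L T \<longleftrightarrow> (\<exists>\<phi> xs ys. formula_has_SOP U L T \<phi> xs ys)"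

definition elementary_embedding ::
  "('f, 'r) signature \<Rightarrow> ('f, 'r, 'a) struct \<Rightarrow> ('f, 'r, 'b) struct \<Rightarrow> ('a \<Rightarrow> 'b) \<Rightarrow> bool"
where
  "elementary_embedding L N M h \<longleftrightarrow> h ` dom_of N \<subseteq> dom_of M \<and>
     (\<forall>\<phi> e. is_formula L \<phi> \<and> range e \<subseteq> dom_of N \<longrightarrow> (sat N e \<phi> \<longleftrightarrow> sat M (h \<circ> e) \<phi>))"

(* HOL cannot quantify over types inside a formula.  The cardinal kappa is a cardinal order whose
   field is a subset of an arbitrary type 'u, and structures and linear orders have carriers that
   are subsets of the same 'u.  As 'u has at least kappa elements, every structure or linear order
   of size at most kappa has an isomorphic copy there, so nothing is lost: see
   universal_model_any_type and universal_linear_order_any_type.  For the strict order property over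
   a countable signature nothing is lost either when kappa is infinite, by the downward
   Loewenheim-Skolem theorem. *)
definition universal_model ::
  "('f, 'r) signature \<Rightarrow> ('f, 'r) fml set \<Rightarrow> 'u rel \<Rightarrow> ('f, 'r, 'u) struct \<Rightarrow> bool"
where
  "universal_model L T \<kappa> M \<longleftrightarrow> is_model L T M \<and> |dom_of M| =o \<kappa> \<and>
     (\<forall>N :: ('f, 'r, 'u) struct. is_model L T N \<and> |dom_of N| \<le>o \<kappa> \<longrightarrow>
        (\<exists>h. elementary_embedding L N M h))"

(* Linear orders are reflexive, so an order-preserving injection automatically reflects the order. *)
definition universal_linear_order :: "'u rel \<Rightarrow> 'u rel \<Rightarrow> bool" where
  "universal_linear_order \<kappa> r \<longleftrightarrow> Linear_order r \<and> |Field r| =o \<kappa> \<and>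
     (\<forall>s :: 'u rel. Linear_order s \<and> |Field s| \<le>o \<kappa> \<longrightarrow>
        (\<exists>f. inj_on f (Field s) \<and> compat s r f))"

lemma inj_into_type_of_cardinal:
  assumes "Card_order (\<kappa> :: 'u rel)" "|A :: 'b set| \<le>o \<kappa>"
  obtains g :: "'b \<Rightarrow> 'u" where "inj_on g A"
proof -
  have "|A| \<le>o |Field \<kappa>|"
    using assms card_of_Field_ordIso ordIso_symmetric ordLeq_ordIso_trans by blast
  then show ?thesis
    using that card_of_ordLeq[of A "Field \<kappa>"] by blast
qed

theorem universal_linear_order_any_type:
  fixes r \<kappa> :: "'u rel" and s :: "'b rel"
  assumes \<kappa>: "Card_order \<kappa>" and r: "universal_linear_order \<kappa> r"
    and s: "Linear_order s" "|Field s| \<le>o \<kappa>"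
  shows "\<exists>f. inj_on f (Field s) \<and> compat s r f"
proof -
  obtain g :: "'b \<Rightarrow> 'u" where g: "inj_on g (Field s)"
    using inj_into_type_of_cardinal[OF \<kappa> s(2)] .
  let ?s = "dir_image s g"
  have F: "Field ?s = g ` Field s" by (simp add: dir_image_Field)
  have "Linear_order ?s" using s(1) g by (rule Linear_order_dir_image)
  moreover have "|Field ?s| \<le>o \<kappa>"
    unfolding F using card_of_image s(2) ordLeq_transitive by blast
  ultimately obtain f where f: "inj_on f (Field ?s)" "compat ?s r f"
    using r unfolding universal_linear_order_def by blast
  have "inj_on (f \<circ> g) (Field s)" using g f(1) F by (simp add: comp_inj_on)
  moreover have "compat s r (f \<circ> g)"
    using f(2) unfolding compat_def dir_image_def by auto
  ultimately show ?thesis by blast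
qed

theorem universal_model_any_type:
  fixes M :: "('f, 'r, 'u) struct" and \<kappa> :: "'u rel" and N :: "('f, 'r, 'b) struct"
  assumes \<kappa>: "Card_order \<kappa>" and T: "is_theory L T" and M: "universal_model L T \<kappa> M"
    and N: "is_model L T N" "|dom_of N| \<le>o \<kappa>"
  shows "\<exists>h. elementary_embedding L N M h"
proof -
  obtain g :: "'b \<Rightarrow> 'u" where g: "inj_on g (dom_of N)"
    using inj_into_type_of_cardinal[OF \<kappa> N(2)] .
  define k where "k = inv_into (dom_of N) g"
  have kg: "k (g a) = a" if "a \<in> dom_of N" for a
    using g that by (simp add: k_def)
  define N' :: "('f, 'r, 'u) struct" where
    "N' = \<lparr>dom_of = g ` dom_of N, fun_int = \<lambda>f as. g (fun_int N f (map k as)),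
           rel_int = \<lambda>r as. rel_int N r (map k as)\<rparr>"
  have st: "is_structure L N" using N(1) by (simp add: is_model_def)
  have fN: "fun_int N f as \<in> dom_of N"
    if "f \<in> funs L" "length as = fun_arity L f" "set as \<subseteq> dom_of N" for f as
    using st that unfolding is_structure_def by blast
  have t: "trm_val N e t \<in> dom_of N \<and> trm_val N' (g \<circ> e) t = g (trm_val N e t)"
    if "is_term L t" "range e \<subseteq> dom_of N" for e t
    using that
  proof (induction t)
    case (Fn f ts)
    have IH: "trm_val N e u \<in> dom_of N \<and> trm_val N' (g \<circ> e) u = g (trm_val N e u)"
      if "u \<in> set ts" for u
      using Fn.IH[OF that] Fn.prems that by (simp add: list_all_iff comp_def)
    have 1: "map k (map (trm_val N' (g \<circ> e)) ts) = map (trm_val N e) ts"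
      using IH kg by auto
    have "trm_val N' (g \<circ> e) (Fn f ts) = g (fun_int N f (map k (map (trm_val N' (g \<circ> e)) ts)))"
      by (simp only: trm_val.simps N'_def struct.simps)
    also have "\<dots> = g (trm_val N e (Fn f ts))"
      unfolding 1 by simp
    finally have "trm_val N' (g \<circ> e) (Fn f ts) = g (trm_val N e (Fn f ts))" .
    moreover have "trm_val N e (Fn f ts) \<in> dom_of N"
      using Fn.prems IH fN[of f "map (trm_val N e) ts"] by auto
    ultimately show ?case by blast
  qed auto
  have s: "sat N' (g \<circ> e) \<phi> \<longleftrightarrow> sat N e \<phi>"
    if "is_formula L \<phi>" "range e \<subseteq> dom_of N" for e \<phi>
    using that
  proof (induction \<phi> arbitrary: e)
    case (Eq x y)
    then show ?case using t[of x e] t[of y e] g by (simp add: inj_on_eq_iff comp_def)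
  next
    case (Rel r ts)
    have "map k (map (trm_val N' (g \<circ> e)) ts) = map (trm_val N e) ts"
      using Rel t kg by (auto simp: list_all_iff)
    then have "rel_int N r (map k (map (trm_val N' (g \<circ> e)) ts)) = rel_int N r (map (trm_val N e) ts)"
      by (rule arg_cong)
    then show ?case by (simp only: sat.simps N'_def struct.simps)
  next
    case (Exists v \<phi>)
    have "sat N' ((g \<circ> e)(v := g a)) \<phi> \<longleftrightarrow> sat N (e(v := a)) \<phi>" if "a \<in> dom_of N" for a
    proof -
      have "range (e(v := a)) \<subseteq> dom_of N" using Exists.prems(2) that by auto
      then have "sat N' (g \<circ> e(v := a)) \<phi> \<longleftrightarrow> sat N (e(v := a)) \<phi>"
        using Exists.IH Exists.prems(1) by (metis is_formula.simps(5))
      moreover have "g \<circ> e(v := a) = (g \<circ> e)(v := g a)" by auto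
      ultimately show ?thesis by metis
    qed
    then have "(\<exists>a\<in>g ` dom_of N. sat N' ((g \<circ> e)(v := a)) \<phi>) \<longleftrightarrow> (\<exists>a\<in>dom_of N. sat N (e(v := a)) \<phi>)"
      unfolding bex_simps(7) by (intro bex_cong refl) metis
    moreover have "dom_of N' = g ` dom_of N" by (simp add: N'_def)
    ultimately show ?case by (simp only: sat.simps)
  qed (simp_all add: comp_def)
  have "is_structure L N'"
    unfolding is_structure_def
  proof (intro conjI ballI allI impI)
    show "dom_of N' \<noteq> {}" using st by (simp add: N'_def is_structure_def)
    fix f as assume f: "f \<in> funs L" "length as = fun_arity L f \<and> set as \<subseteq> dom_of N'"
    then have "set (map k as) \<subseteq> dom_of N" using kg by (auto simp: N'_def)
    then show "fun_int N' f as \<in> dom_of N'" using f fN[of f "map k as"] by (simp add: N'_def)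
  qed
  moreover have "sat N' e \<phi>" if "\<phi> \<in> T" "range e \<subseteq> dom_of N'" for e \<phi>
  proof -
    have e: "k (e v) \<in> dom_of N \<and> g (k (e v)) = e v" for v
    proof -
      have "e v \<in> g ` dom_of N" using that(2) by (auto simp: N'_def)
      then obtain a where "a \<in> dom_of N" "e v = g a" by blast
      then show ?thesis using kg by simp
    qed
    have 1: "range (k \<circ> e) \<subseteq> dom_of N" using e by auto
    have 2: "g \<circ> (k \<circ> e) = e" using e by auto
    have "sat N (k \<circ> e) \<phi>" using 1 N(1) that(1) unfolding is_model_def by blast
    then have "sat N' (g \<circ> (k \<circ> e)) \<phi>"
      using s[OF _ 1, of \<phi>] T that(1) unfolding is_theory_def by blast
    then show ?thesis unfolding 2 .
  qed
  ultimately have "is_model L T N'" by (simp add: is_model_def)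
  moreover have "|dom_of N'| \<le>o \<kappa>"
    using card_of_image[of g "dom_of N"] N(2) ordLeq_transitive by (auto simp: N'_def)
  ultimately obtain h where h: "elementary_embedding L N' M h"
    using M unfolding universal_model_def by blast
  have "elementary_embedding L N M (h \<circ> g)"
    unfolding elementary_embedding_def
  proof (intro conjI allI impI)
    show "(h \<circ> g) ` dom_of N \<subseteq> dom_of M"
      using h by (auto simp: elementary_embedding_def N'_def)
    fix \<phi> :: "('f, 'r) fml" and e :: "nat \<Rightarrow> 'b" assume a: "is_formula L \<phi> \<and> range e \<subseteq> dom_of N"
    then have "range (g \<circ> e) \<subseteq> dom_of N'" by (auto simp: N'_def)
    then have "sat N' (g \<circ> e) \<phi> \<longleftrightarrow> sat M (h \<circ> (g \<circ> e)) \<phi>"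
      using h a by (simp add: elementary_embedding_def)
    then show "sat N e \<phi> \<longleftrightarrow> sat M ((h \<circ> g) \<circ> e) \<phi>" using s[of \<phi> e] a by (simp only: comp_assoc)
  qed
  then show ?thesis by blast
qed

end

theory Submission
  imports Defs
begin

text \<open>
  Let \<open>\<phi>(x; y)\<close> have the strict order property and let \<open>M\<close> be universal in \<open>\<kappa>\<close>. The parameter
  tuples of \<open>M\<close> are quasi-ordered by inclusion of the sets \<open>\<phi>(M; a)\<close>; there are at most \<open>\<kappa>\<close> such
  sets. Their inclusion order is only partial, but it contains a copy of every linear order \<open>s\<close> of
  size at most \<open>\<kappa>\<close>, as a chain. Hence any linear order on these sets that extends inclusion
  contains a copy of every such \<open>s\<close>, because extending the order does not change it on chains. Such an
  order has exactly \<open>\<kappa>\<close> elements, as the well-order \<open>\<kappa>\<close> itself is one of the linear orders that embed.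

  The chain for \<open>s\<close> is the content of \<open>SOP_chain_of_definable_sets\<close>. The strict order property
  provides chains of every finite length in models of \<open>T\<close>. Assigning to each finite subset \<open>X\<close> of \<open>s\<close>
  a model with a chain indexed by \<open>X\<close>, and taking an ultraproduct along an ultrafilter that
  contains every cone \<open>{X. X0 \<subseteq> X}\<close>, gives a model of \<open>T\<close> with a chain indexed by \<open>s\<close>
  (\<open>sat_ultraproduct\<close>); the downward Loewenheim-Skolem theorem cuts it down to size \<open>\<kappa>\<close>, and then it
  embeds elementarily into \<open>M\<close>. An elementary embedding respects the comparison of two parameter
  tuples because this comparison is itself expressed by a formula (\<open>sat_not_included\<close>).
\<close>

section \<open>A linear order on a family of sets\<close>

text \<open>
  Identify sets with characteristic functions over a well-ordered type. The lexicographic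
  order of such functions is linear and extends inclusion, since the first difference between
  \<open>A \<subseteq> B\<close> is necessarily an element of \<open>B\<close>.
\<close>

lemma linear_order_extending_inclusion:
  fixes G :: "'a set set"
  obtains r where "Linear_order r" "Field r = G"
    "\<forall>A\<in>G. \<forall>B\<in>G. A \<subseteq> B \<longrightarrow> (A, B) \<in> r"
proof -
  obtain w :: "'a rel" where w: "Well_order w" "Field w = UNIV"
    using well_ordering[where 'a = 'a] by blast
  define lt where "lt = (\<lambda>x y. (x, y) \<in> w \<and> x \<noteq> y)"
  have w_trans: "trans w" and w_anti: "antisym w" and w_total: "total_on UNIV w" and w_wf: "wf (w - Id)"
    using w by (simp_all add: order_on_defs)
  have lt_trans: "lt x z" if "lt x y" "lt y z" for x y z
    using that transD[OF w_trans] antisymD[OF w_anti] unfolding lt_def by metis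
  have lt_total: "lt x y \<or> x = y \<or> lt y x" for x y
    using w_total unfolding lt_def total_on_def by auto
  have lt_min: "\<exists>x\<in>D. \<forall>y. lt y x \<longrightarrow> y \<notin> D" if D: "D \<noteq> {}" for D
  proof -
    obtain x where "x \<in> D" "\<And>y. (y, x) \<in> w - Id \<Longrightarrow> y \<notin> D"
      using wfE_min'[OF w_wf D] by blast
    then show ?thesis unfolding lt_def by auto
  qed
  define first where "first = (\<lambda>A B x. x \<in> B - A \<and> (\<forall>y. lt y x \<longrightarrow> (y \<in> A \<longleftrightarrow> y \<in> B)))"
  define r where "r = {(A, B). A \<in> G \<and> B \<in> G \<and> (A = B \<or> (\<exists>x. first A B x))}"
  have first_trans: "\<exists>z. first A C z" if "first A B x" "first B C y" for A B C x y
  proof -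
    consider "lt x y" | "x = y" | "lt y x" using lt_total by blast
    then show ?thesis
    proof cases
      case 1
      then have "first A C x" using that lt_trans unfolding first_def by blast
      then show ?thesis ..
    next
      case 2
      then show ?thesis using that unfolding first_def by blast
    next
      case 3
      then have "first A C y" using that lt_trans unfolding first_def by blast
      then show ?thesis ..
    qed
  qed
  have first_asym: False if f: "first A B x" "first B A y" for A B x y
  proof -
    have "\<not> lt x y" "x \<noteq> y" "\<not> lt y x" using f unfolding first_def by auto
    then show False using lt_total[of x y] by simp
  qed
  have first_total: "(\<exists>x. first A B x) \<or> (\<exists>x. first B A x)" if ne: "A \<noteq> B" for A B
  proof -
    have "(A - B) \<union> (B - A) \<noteq> {}" using ne by auto
    from lt_min[OF this] obtain x where
      x: "x \<in> (A - B) \<union> (B - A)" "\<And>y. lt y x \<Longrightarrow> y \<notin> (A - B) \<union> (B - A)"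
      by blast
    have "\<forall>y. lt y x \<longrightarrow> (y \<in> A \<longleftrightarrow> y \<in> B)" using x(2) by auto
    then have "first A B x \<or> first B A x" using x(1) unfolding first_def by auto
    then show ?thesis by auto
  qed
  have F: "Field r = G" unfolding r_def Field_def by auto
  have "refl_on G r" unfolding r_def refl_on_def by auto
  moreover have "trans r"
  proof (rule transI)
    fix A B C assume AB: "(A, B) \<in> r" and BC: "(B, C) \<in> r"
    show "(A, C) \<in> r"
    proof (cases "A = B \<or> B = C")
      case True
      then show ?thesis using AB BC by auto
    next
      case False
      then obtain x y where "first A B x" "first B C y" using AB BC unfolding r_def by auto
      then have "\<exists>z. first A C z" by (rule first_trans)
      then show ?thesis using AB BC unfolding r_def by auto
    qed
  qed
  moreover have "antisym r"
    by (rule antisymI) (use first_asym in \<open>auto simp: r_def\<close>)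
  moreover have "total_on G r"
    unfolding total_on_def r_def using first_total by auto
  moreover have "r \<subseteq> G \<times> G" unfolding r_def by auto
  ultimately have "Linear_order r" by (simp add: order_on_defs F)
  moreover have incl: "(A, B) \<in> r" if "A \<in> G" "B \<in> G" "A \<subseteq> B" for A B
  proof -
    have "\<not> first B A x" for x using that(3) unfolding first_def by blast
    then show ?thesis using that first_total[of A B] unfolding r_def by auto
  qed
  ultimately show ?thesis using F that by simp
qed

section \<open>Ultrafilters\<close>

text \<open>
  In the order of type \<open>filter\<close> a finer filter is smaller, so Zorn's lemma is applied to \<open>\<ge>\<close> and
  an ultrafilter is a minimal proper filter.
\<close>

lemma ultrafilter_below:
  fixes F :: "'i filter"
  assumes "F \<noteq> bot"
  obtains U where "U \<le> F" "U \<noteq> bot"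
    "\<forall>P. eventually P U \<or> eventually (\<lambda>i. \<not> P i) U"
proof -
  let ?A = "{G. G \<le> F \<and> G \<noteq> bot}"
  have "\<exists>U\<in>?A. \<forall>G\<in>?A. U \<ge> G \<longrightarrow> G = U"
  proof (rule predicate_Zorn)
    show "partial_order_on ?A (relation_of (\<ge>) ?A)"
      by (rule partial_order_on_relation_ofI) auto
  next
    fix C assume C: "C \<in> Chains (relation_of (\<ge>) ?A)"
    show "\<exists>u\<in>?A. \<forall>a\<in>C. u \<le> a"
    proof (cases "C = {}")
      case True
      then show ?thesis using assms by auto
    next
      case False
      have sub: "C \<subseteq> ?A" using C by (rule Chains_relation_of)
      have "\<exists>x\<in>C. x \<le> inf a b" if "a \<in> C" "b \<in> C" for a b
        using C that unfolding Chains_def relation_of_def by (auto intro: inf.absorb1)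
      then have "eventually P (Inf C) \<longleftrightarrow> (\<exists>b\<in>C. eventually P b)" for P
        using False by (intro eventually_Inf_base)
      then have "Inf C \<noteq> bot" using sub unfolding trivial_limit_def by blast
      moreover have "Inf C \<le> F"
        using False sub by (auto intro: Inf_lower2)
      ultimately show ?thesis by (auto intro: Inf_lower)
    qed
  qed
  then obtain U where U: "U \<le> F" "U \<noteq> bot" and max: "\<And>G. G \<le> U \<Longrightarrow> G \<noteq> bot \<Longrightarrow> G = U"
    using order_trans by auto
  (* If P is frequently true, then restricting U to P leaves a proper filter, which is U again. *)
  have ultra: "eventually P U" if "\<not> eventually (\<lambda>i. \<not> P i) U" for P
  proof -
    have "inf U (principal {i. P i}) \<noteq> bot"
      using that by (simp add: trivial_limit_def eventually_inf_principal)
    then have "inf U (principal {i. P i}) = U" by (intro max) auto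
    then have "U \<le> principal {i. P i}" by (metis inf_le2)
    then show ?thesis by (simp add: le_principal)
  qed
  show ?thesis by (rule that[OF U]) (use ultra in blast)
qed

section \<open>Ultraproducts\<close>

text \<open>
  The elements of the ultraproduct are canonical representatives rather than equivalence classes,
  so that they are again functions on the index type. A representative agrees with a
  choice function of the domains only up to the ultrafilter and may lie outside a domain at some
  indices; the domain is therefore the image of the set of choice functions.
\<close>

definition ultra_rep :: "'i filter \<Rightarrow> ('i \<Rightarrow> 'u) \<Rightarrow> 'i \<Rightarrow> 'u" where
  "ultra_rep U f = (SOME g. \<forall>\<^sub>F i in U. f i = g i)"

definition ultraproduct ::
  "'i filter \<Rightarrow> ('i \<Rightarrow> ('f, 'r, 'u) struct) \<Rightarrow> ('f, 'r, 'i \<Rightarrow> 'u) struct"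
where
  "ultraproduct U M =
    \<lparr>dom_of = ultra_rep U ` {f. \<forall>i. f i \<in> dom_of (M i)},
     fun_int = \<lambda>F as. ultra_rep U (\<lambda>i. fun_int (M i) F (map (\<lambda>a. a i) as)),
     rel_int = \<lambda>R as. \<forall>\<^sub>F i in U. rel_int (M i) R (map (\<lambda>a. a i) as)\<rparr>"

lemma ultra_rep_eventually: "\<forall>\<^sub>F i in U. f i = ultra_rep U f i"
  unfolding ultra_rep_def by (rule someI[of _ f]) simp

lemma ultra_rep_cong:
  assumes "\<forall>\<^sub>F i in U. f i = g i"
  shows "ultra_rep U f = ultra_rep U g"
proof -
  have "(\<forall>\<^sub>F i in U. f i = h i) \<longleftrightarrow> (\<forall>\<^sub>F i in U. g i = h i)" for h
    using assms by (auto elim: eventually_elim2)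
  then show ?thesis by (simp add: ultra_rep_def)
qed

lemma ultra_rep_eq_iff: "ultra_rep U f = ultra_rep U g \<longleftrightarrow> (\<forall>\<^sub>F i in U. f i = g i)"
proof
  assume eq: "ultra_rep U f = ultra_rep U g"
  show "\<forall>\<^sub>F i in U. f i = g i"
    using ultra_rep_eventually[of f U] ultra_rep_eventually[of g U]
    by eventually_elim (simp add: eq)
qed (rule ultra_rep_cong)

lemma ultraproduct_sel:
  "dom_of (ultraproduct U M) = ultra_rep U ` {f. \<forall>i. f i \<in> dom_of (M i)}"
  "fun_int (ultraproduct U M) F as = ultra_rep U (\<lambda>i. fun_int (M i) F (map (\<lambda>a. a i) as))"
  "rel_int (ultraproduct U M) R as \<longleftrightarrow> (\<forall>\<^sub>F i in U. rel_int (M i) R (map (\<lambda>a. a i) as))"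
  by (simp_all add: ultraproduct_def)

text \<open>
  Replacing a list of functions by their representatives changes only finitely many entries, each
  on a set that the filter ignores.
\<close>

lemma eventually_map_ultra_rep:
  fixes P :: "'i \<Rightarrow> 'u list \<Rightarrow> 'x"
  shows "\<forall>\<^sub>F i in U. P i (map (\<lambda>a. a i) (map (\<lambda>t. ultra_rep U (g t)) ts)) = P i (map (\<lambda>t. g t i) ts)"
proof -
  have "\<forall>\<^sub>F i in U. \<forall>t\<in>set ts. g t i = ultra_rep U (g t) i"
    by (intro eventually_ball_finite ballI ultra_rep_eventually) simp
  then show ?thesis
  proof (rule eventually_mono)
    fix i assume "\<forall>t\<in>set ts. g t i = ultra_rep U (g t) i"
    then have "map (\<lambda>a. a i) (map (\<lambda>t. ultra_rep U (g t)) ts) = map (\<lambda>t. g t i) ts" by simp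
    then show "P i (map (\<lambda>a. a i) (map (\<lambda>t. ultra_rep U (g t)) ts)) = P i (map (\<lambda>t. g t i) ts)"
      by (rule arg_cong)
  qed
qed

lemma fun_int_ultraproduct:
  "fun_int (ultraproduct U M) F (map (\<lambda>t. ultra_rep U (g t)) ts) =
    ultra_rep U (\<lambda>i. fun_int (M i) F (map (\<lambda>t. g t i) ts))"
  unfolding ultraproduct_sel by (intro ultra_rep_cong eventually_map_ultra_rep)

lemma rel_int_ultraproduct:
  "rel_int (ultraproduct U M) R (map (\<lambda>t. ultra_rep U (g t)) ts) \<longleftrightarrow>
    (\<forall>\<^sub>F i in U. rel_int (M i) R (map (\<lambda>t. g t i) ts))"
  unfolding ultraproduct_sel
  by (rule eventually_subst, rule eventually_map_ultra_rep)

lemma trm_val_ultraproduct: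
  "trm_val (ultraproduct U M) (\<lambda>v. ultra_rep U (e v)) t =
     ultra_rep U (\<lambda>i. trm_val (M i) (\<lambda>v. e v i) t)"
proof (induction t)
  case (Fn F ts)
  then have "map (trm_val (ultraproduct U M) (\<lambda>v. ultra_rep U (e v))) ts =
      map (\<lambda>t. ultra_rep U (\<lambda>i. trm_val (M i) (\<lambda>v. e v i) t)) ts"
    by simp
  then show ?case by (simp only: trm_val.simps fun_int_ultraproduct)
qed simp

text \<open>
  Los's theorem. The ultrafilter property is needed for negation and the axiom of choice, applied to
  witnesses at all indices, for the existential quantifier. Assignments are given by arbitrary
  functions on the index type, not by representatives, so that updating an assignment commutes with evaluation
  at an index.
\<close>

lemma sat_ultraproduct:
  assumes ultra: "U \<noteq> bot" "\<forall>P. eventually P U \<or> eventually (\<lambda>i. \<not> P i) U"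
    and ne: "\<And>i. dom_of (M i) \<noteq> {}"
  shows "sat (ultraproduct U M) (\<lambda>v. ultra_rep U (e v)) \<phi> \<longleftrightarrow>
    (\<forall>\<^sub>F i in U. sat (M i) (\<lambda>v. e v i) \<phi>)"
proof (induction \<phi> arbitrary: e)
  case (Eq s t)
  show ?case by (simp add: trm_val_ultraproduct ultra_rep_eq_iff)
next
  case (Rel R ts)
  have "map (trm_val (ultraproduct U M) (\<lambda>v. ultra_rep U (e v))) ts =
      map (\<lambda>t. ultra_rep U (\<lambda>i. trm_val (M i) (\<lambda>v. e v i) t)) ts"
    by (simp add: trm_val_ultraproduct)
  then show ?case by (simp only: sat.simps rel_int_ultraproduct)
next
  case (Neg \<phi>)
  have "(\<forall>\<^sub>F i in U. \<not> sat (M i) (\<lambda>v. e v i) \<phi>) \<longleftrightarrow> \<not> (\<forall>\<^sub>F i in U. sat (M i) (\<lambda>v. e v i) \<phi>)"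
    using eventually_conj[of "\<lambda>i. sat (M i) (\<lambda>v. e v i) \<phi>" U "\<lambda>i. \<not> sat (M i) (\<lambda>v. e v i) \<phi>"]
      ultra(2)[rule_format, of "\<lambda>i. sat (M i) (\<lambda>v. e v i) \<phi>"] ultra(1)
    by auto
  then show ?case using Neg by simp
next
  case (Conj \<phi> \<psi>)
  then show ?case by (simp add: eventually_conj_iff)
next
  case (Exists x \<phi>)
  let ?D = "{f. \<forall>i. f i \<in> dom_of (M i)}"
  have upd: "sat (ultraproduct U M) ((\<lambda>v. ultra_rep U (e v))(x := ultra_rep U f)) \<phi> \<longleftrightarrow>
      (\<forall>\<^sub>F i in U. sat (M i) ((\<lambda>v. e v i)(x := f i)) \<phi>)" for f
  proof -
    have "(\<lambda>v. ultra_rep U (e v))(x := ultra_rep U f) = (\<lambda>v. ultra_rep U ((e(x := f)) v))"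
      by auto
    moreover have "(\<lambda>v. (e(x := f)) v i) = (\<lambda>v. e v i)(x := f i)" for i by auto
    ultimately show ?thesis using Exists.IH[of "e(x := f)"] by simp
  qed
  have "sat (ultraproduct U M) (\<lambda>v. ultra_rep U (e v)) (Exists x \<phi>) \<longleftrightarrow>
      (\<exists>f\<in>?D. \<forall>\<^sub>F i in U. sat (M i) ((\<lambda>v. e v i)(x := f i)) \<phi>)"
    using upd by (simp add: ultraproduct_def)
  also have "\<dots> \<longleftrightarrow> (\<forall>\<^sub>F i in U. \<exists>a\<in>dom_of (M i). sat (M i) ((\<lambda>v. e v i)(x := a)) \<phi>)"
  proof
    assume "\<exists>f\<in>?D. \<forall>\<^sub>F i in U. sat (M i) ((\<lambda>v. e v i)(x := f i)) \<phi>"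
    then obtain f where "f \<in> ?D" "\<forall>\<^sub>F i in U. sat (M i) ((\<lambda>v. e v i)(x := f i)) \<phi>" ..
    then show "\<forall>\<^sub>F i in U. \<exists>a\<in>dom_of (M i). sat (M i) ((\<lambda>v. e v i)(x := a)) \<phi>"
      by (auto elim!: eventually_mono)
  next
    assume ev: "\<forall>\<^sub>F i in U. \<exists>a\<in>dom_of (M i). sat (M i) ((\<lambda>v. e v i)(x := a)) \<phi>"
    have "\<forall>i. \<exists>a\<in>dom_of (M i). (\<exists>a\<in>dom_of (M i). sat (M i) ((\<lambda>v. e v i)(x := a)) \<phi>) \<longrightarrow>
        sat (M i) ((\<lambda>v. e v i)(x := a)) \<phi>"
      using ne by blast
    then obtain f where f: "\<forall>i. f i \<in> dom_of (M i) \<and>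
        ((\<exists>a\<in>dom_of (M i). sat (M i) ((\<lambda>v. e v i)(x := a)) \<phi>) \<longrightarrow>
          sat (M i) ((\<lambda>v. e v i)(x := f i)) \<phi>)"
      unfolding Bex_def by metis
    have "\<forall>\<^sub>F i in U. sat (M i) ((\<lambda>v. e v i)(x := f i)) \<phi>"
      using ev by (rule eventually_mono) (use f in blast)
    then show "\<exists>f\<in>?D. \<forall>\<^sub>F i in U. sat (M i) ((\<lambda>v. e v i)(x := f i)) \<phi>"
      using f by blast
  qed
  finally show ?case by simp
qed

lemma is_model_ultraproduct:
  assumes ultra: "U \<noteq> bot" "\<forall>P. eventually P U \<or> eventually (\<lambda>i. \<not> P i) U"
    and M: "\<And>i. is_model L T (M i)"
  shows "is_model L T (ultraproduct U M)"
proof -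
  let ?N = "ultraproduct U M" and ?D = "{f. \<forall>i. f i \<in> dom_of (M i)}"
  have st: "is_structure L (M i)" for i using M by (simp add: is_model_def)
  have ne: "dom_of (M i) \<noteq> {}" for i using st by (simp add: is_structure_def)
  have dom: "dom_of ?N = ultra_rep U ` ?D" by (rule ultraproduct_sel)
  have "is_structure L ?N"
    unfolding is_structure_def
  proof (intro conjI ballI allI impI)
    have "(\<lambda>i. SOME a. a \<in> dom_of (M i)) \<in> ?D" using ne some_in_eq by blast
    then have "ultra_rep U (\<lambda>i. SOME a. a \<in> dom_of (M i)) \<in> dom_of ?N"
      unfolding dom by (rule imageI)
    then show "dom_of ?N \<noteq> {}" by blast
    fix F as assume F: "F \<in> funs L" and as: "length as = fun_arity L F \<and> set as \<subseteq> dom_of ?N"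
    define g where "g = inv_into ?D (ultra_rep U)"
    have g: "g a \<in> ?D" "ultra_rep U (g a) = a" if "a \<in> set as" for a
    proof -
      have "a \<in> ultra_rep U ` ?D" using as that unfolding dom by blast
      then show "g a \<in> ?D" "ultra_rep U (g a) = a"
        unfolding g_def by (rule inv_into_into, rule f_inv_into_f)
    qed
    have "fun_int (M i) F (map (\<lambda>a. g a i) as) \<in> dom_of (M i)" for i
    proof -
      have "length (map (\<lambda>a. g a i) as) = fun_arity L F" "set (map (\<lambda>a. g a i) as) \<subseteq> dom_of (M i)"
        using as g(1) by auto
      then show ?thesis using st[of i] F unfolding is_structure_def by blast
    qed
    moreover have "fun_int ?N F as = ultra_rep U (\<lambda>i. fun_int (M i) F (map (\<lambda>a. g a i) as))"
      using fun_int_ultraproduct[of U M F g as] g(2) by (simp add: map_idI)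
    ultimately show "fun_int ?N F as \<in> dom_of ?N" unfolding dom by blast
  qed
  moreover have "sat ?N e \<phi>" if "\<phi> \<in> T" "range e \<subseteq> dom_of ?N" for e \<phi>
  proof -
    have "\<forall>v. \<exists>f\<in>?D. e v = ultra_rep U f" using that(2) unfolding dom by blast
    then obtain e0 where e0: "\<And>v. e0 v \<in> ?D" "\<And>v. e v = ultra_rep U (e0 v)" by metis
    have "range (\<lambda>v. e0 v i) \<subseteq> dom_of (M i)" for i using e0(1) by auto
    then have "sat (M i) (\<lambda>v. e0 v i) \<phi>" for i
      using M[of i] that(1) by (simp add: is_model_def)
    then have "sat ?N (\<lambda>v. ultra_rep U (e0 v)) \<phi>"
      unfolding sat_ultraproduct[OF ultra ne] by (intro always_eventually allI)
    moreover have "e = (\<lambda>v. ultra_rep U (e0 v))" using e0(2) by (rule ext)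
    ultimately show ?thesis by (simp only:)
  qed
  ultimately show ?thesis by (simp add: is_model_def)
qed

section \<open>The downward Loewenheim-Skolem theorem\<close>

instance trm :: (countable) countable
  by countable_datatype

instance fml :: (countable, countable) countable
  by countable_datatype

lemma is_term_set_trm: "is_term L t \<Longrightarrow> set_trm t \<subseteq> funs L"
  by (induction t) (auto simp: list_all_iff)

lemma is_formula_set_fml: "is_formula L \<phi> \<Longrightarrow> set1_fml \<phi> \<subseteq> funs L \<and> set2_fml \<phi> \<subseteq> rels L"
  by (induction \<phi>) (auto simp: list_all_iff dest!: is_term_set_trm)

text \<open>
  The types of symbols may be uncountable, but the formulas of \<open>L\<close> only mention the countably many
  symbols of \<open>L\<close>; numbering these embeds the formulas into those over a countable vocabulary.
\<close>

lemma countable_formulas: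
  fixes L :: "('f, 'r) signature"
  assumes "countable_signature L"
  shows "countable {\<phi>. is_formula L \<phi>}"
proof -
  let ?f = "to_nat_on (funs L)" and ?g = "to_nat_on (rels L)"
  have f: "inj_on ?f (funs L)" and g: "inj_on ?g (rels L)"
    using assms by (auto simp: countable_signature_def)
  have "inj_on (map_fml ?f ?g) {\<phi>. is_formula L \<phi>}"
  proof (rule inj_onI)
    fix \<phi> \<psi> :: "('f, 'r) fml" assume "\<phi> \<in> {\<phi>. is_formula L \<phi>}" "\<psi> \<in> {\<phi>. is_formula L \<phi>}"
    then have "set1_fml \<phi> \<subseteq> funs L" "set2_fml \<phi> \<subseteq> rels L" "set1_fml \<psi> \<subseteq> funs L" "set2_fml \<psi> \<subseteq> rels L"
      using is_formula_set_fml by auto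
    moreover assume "map_fml ?f ?g \<phi> = map_fml ?f ?g \<psi>"
    ultimately show "\<phi> = \<psi>"
      by (intro fml.inj_map_strong[of \<phi> \<psi> ?f ?f ?g ?g]) (use f g in \<open>auto dest: inj_onD\<close>)
  qed
  then show ?thesis by (rule countable_image_inj_on[rotated]) simp
qed

lemma finite_trm_vars: "finite (trm_vars t)"
  by (induction t) auto

lemma finite_free_vars: "finite (free_vars \<phi>)"
  by (induction \<phi>) (auto simp: finite_trm_vars)

lemma trm_val_cong: "(\<And>v. v \<in> trm_vars t \<Longrightarrow> e v = e' v) \<Longrightarrow> trm_val M e t = trm_val M e' t"
proof (induction t)
  case (Fn f ts)
  then have "map (trm_val M e) ts = map (trm_val M e') ts" by fastforce
  then show ?case by (simp only: trm_val.simps)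
qed simp

lemma sat_cong: "(\<And>v. v \<in> free_vars \<phi> \<Longrightarrow> e v = e' v) \<Longrightarrow> sat M e \<phi> \<longleftrightarrow> sat M e' \<phi>"
proof (induction \<phi> arbitrary: e e')
  case (Eq s t)
  then show ?case using trm_val_cong[of s e e' M] trm_val_cong[of t e e' M] by simp
next
  case (Rel R ts)
  have "map (trm_val M e) ts = map (trm_val M e') ts"
  proof (rule map_cong[OF refl])
    fix t assume "t \<in> set ts"
    then show "trm_val M e t = trm_val M e' t" by (intro trm_val_cong Rel) auto
  qed
  then show ?case by (simp only: sat.simps)
next
  case (Neg \<phi>)
  have "sat M e \<phi> \<longleftrightarrow> sat M e' \<phi>" by (rule Neg.IH) (simp add: Neg.prems)
  then show ?case by simp
next
  case (Conj \<phi> \<psi>)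
  have "sat M e \<phi> \<longleftrightarrow> sat M e' \<phi>" by (rule Conj.IH(1)) (simp add: Conj.prems)
  moreover have "sat M e \<psi> \<longleftrightarrow> sat M e' \<psi>" by (rule Conj.IH(2)) (simp add: Conj.prems)
  ultimately show ?case by simp
next
  case (Exists x \<phi>)
  have "sat M (e(x := a)) \<phi> \<longleftrightarrow> sat M (e'(x := a)) \<phi>" for a
    by (rule Exists.IH) (simp add: Exists.prems)
  then show ?case by simp
qed

lemma countable_card_le:
  assumes "Cinfinite \<kappa>" "countable A"
  shows "|A| \<le>o \<kappa>"
proof -
  have "|A| \<le>o |UNIV :: nat set|"
    using assms(2) card_of_ordLeq unfolding countable_def by blast
  then show ?thesis
    using card_of_nat natLeq_ordLeq_cinfinite[OF assms(1)] ordLeq_ordIso_trans ordLeq_transitive by blast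
qed

lemma card_of_lists_length_le:
  assumes "Cinfinite \<kappa>" "|A| \<le>o \<kappa>"
  shows "|{as. length as = n \<and> set as \<subseteq> A}| \<le>o \<kappa>"
proof (induction n)
  case 0
  have "{as. length as = 0 \<and> set as \<subseteq> A} = {[]}" by auto
  then show ?case using countable_card_le[OF assms(1), of "{[]}"] by simp
next
  case (Suc n)
  have "{as. length as = Suc n \<and> set as \<subseteq> A} \<subseteq> (\<lambda>(a, as). a # as) ` (A \<times> {as. length as = n \<and> set as \<subseteq> A})"
    by (auto simp: length_Suc_conv image_iff)
  then have "|{as. length as = Suc n \<and> set as \<subseteq> A}| \<le>o |A \<times> {as. length as = n \<and> set as \<subseteq> A}|"
    by (meson card_of_image card_of_mono1 ordLeq_transitive)
  moreover have "|A \<times> {as. length as = n \<and> set as \<subseteq> A}| \<le>o \<kappa>"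
    using assms Suc unfolding cinfinite_def by (intro card_of_Times_ordLeq_infinite_Field) auto
  ultimately show ?case using ordLeq_transitive by blast
qed

lemma card_of_lists_le:
  assumes "Cinfinite \<kappa>" "|A| \<le>o \<kappa>"
  shows "|lists A| \<le>o \<kappa>"
proof -
  have "lists A = (\<Union>n::nat. {as. length as = n \<and> set as \<subseteq> A})" by (auto simp: lists_eq_set)
  also have "|\<dots>| \<le>o \<kappa>"
    using card_of_lists_length_le[OF assms] countable_card_le[OF assms(1), of "UNIV :: nat set"]
    by (intro UNION_Cinfinite_bound ballI assms(1)) auto
  finally show ?thesis .
qed

text \<open>
  Close \<open>A\<close> under Skolem functions in \<open>\<omega>\<close> steps. A Skolem function takes a formula, the quantified
  variable and a finite list of parameters, and there are at most \<open>\<kappa>\<close> such data over a set of size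
  at most \<open>\<kappa>\<close>. Closure under the functions of \<open>L\<close> comes for free: the value \<open>f(x)\<close> is the only
  witness of \<open>\<exists>y. y = f(x)\<close>.
\<close>

lemma downward_Loewenheim_Skolem:
  fixes N :: "('f, 'r, 'a) struct" and \<kappa> :: "'k rel"
  assumes L: "countable_signature L" and \<kappa>: "Cinfinite \<kappa>"
    and N: "is_structure L N" and A: "A \<subseteq> dom_of N" "|A| \<le>o \<kappa>"
  obtains S where "A \<subseteq> S" "S \<subseteq> dom_of N" "|S| \<le>o \<kappa>" "is_structure L (N\<lparr>dom_of := S\<rparr>)"
    "\<forall>\<phi> e. is_formula L \<phi> \<longrightarrow> range e \<subseteq> S \<longrightarrow> (sat (N\<lparr>dom_of := S\<rparr>) e \<phi> \<longleftrightarrow> sat N e \<phi>)"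
proof -
  obtain d where d: "d \<in> dom_of N" using N unfolding is_structure_def by blast
  define sk where "sk = (\<lambda>\<phi> x e.
    SOME a. a \<in> dom_of N \<and> ((\<exists>a\<in>dom_of N. sat N (e(x := a)) \<phi>) \<longrightarrow> sat N (e(x := a)) \<phi>))"
  have sk: "sk \<phi> x e \<in> dom_of N \<and>
      ((\<exists>a\<in>dom_of N. sat N (e(x := a)) \<phi>) \<longrightarrow> sat N (e(x := sk \<phi> x e)) \<phi>)" for \<phi> x e
    unfolding sk_def by (rule someI_ex) (use d in blast)
  define env where "env = (\<lambda>as v. if v < length as then as ! v else d)"
  define step where "step = (\<lambda>S. S \<union> (\<lambda>(\<phi>, x, as). sk \<phi> x (env as)) ` ({\<phi>. is_formula L \<phi>} \<times> UNIV \<times> lists S))"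
  define H where "H = (\<lambda>n. (step ^^ n) (insert d A))"
  define S where "S = (\<Union>n. H n)"
  have H_Suc: "H (Suc n) = step (H n)" for n by (simp add: H_def)
  have inf: "infinite (Field \<kappa>)" using \<kappa> by (simp add: cinfinite_def)
  have "|H n| \<le>o \<kappa>" for n
  proof (induction n)
    case 0
    have "|{d} \<union> A| \<le>o \<kappa>"
      using \<kappa> A(2) countable_card_le[OF \<kappa>, of "{d}"] by (intro Un_Cinfinite_bound) auto
    then show ?case by (simp add: H_def)
  next
    case (Suc n)
    have "|{\<phi>. is_formula L \<phi>} \<times> (UNIV :: nat set) \<times> lists (H n)| \<le>o \<kappa>"
      using \<kappa> inf Suc countable_card_le[OF \<kappa> countable_formulas[OF L]]
        countable_card_le[OF \<kappa>, of "UNIV :: nat set"] card_of_lists_le[OF \<kappa>, of "H n"]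
      by (intro card_of_Times_ordLeq_infinite_Field) auto
    then have "|(\<lambda>(\<phi>, x, as). sk \<phi> x (env as)) ` ({\<phi>. is_formula L \<phi>} \<times> UNIV \<times> lists (H n))| \<le>o \<kappa>"
      using card_of_image ordLeq_transitive by blast
    then show ?case unfolding H_Suc step_def using Suc \<kappa> by (intro Un_Cinfinite_bound) auto
  qed
  then have card: "|S| \<le>o \<kappa>"
    unfolding S_def using \<kappa> countable_card_le[OF \<kappa>, of "UNIV :: nat set"]
    by (intro UNION_Cinfinite_bound) auto
  have "H n \<subseteq> dom_of N" for n
    by (induction n) (use A(1) d sk in \<open>auto simp: H_Suc step_def\<close>, auto simp: H_def)
  then have SN: "S \<subseteq> dom_of N" unfolding S_def by blast
  have dS: "d \<in> S" and AS: "A \<subseteq> S"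
    unfolding S_def by (auto intro!: exI[of _ 0] simp: H_def)
  have mono: "H m \<subseteq> H n" if "m \<le> n" for m n
    using that by (induction rule: dec_induct) (auto simp: H_Suc step_def)
  have sk_list: "sk \<phi> x (env as) \<in> S" if "is_formula L \<phi>" "set as \<subseteq> S" for \<phi> x as
  proof -
    have "\<exists>n. set as \<subseteq> H n" using that(2)
    proof (induction as)
      case (Cons a as)
      then obtain m n where "set as \<subseteq> H n" "a \<in> H m" unfolding S_def by auto
      then have "set (a # as) \<subseteq> H (max m n)" using mono[of m "max m n"] mono[of n "max m n"] by auto
      then show ?case ..
    qed simp
    then obtain n where "set as \<subseteq> H n" ..
    then have "sk \<phi> x (env as) \<in> step (H n)"
      unfolding step_def using that(1) by (force simp: lists_eq_set)
    then show ?thesis unfolding S_def H_Suc[symmetric] by blast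
  qed
  (* The Tarski-Vaught criterion. *)
  have witness: "\<exists>a\<in>S. sat N (e(x := a)) \<phi>"
    if "is_formula L \<phi>" "range e \<subseteq> S" "a \<in> dom_of N" "sat N (e(x := a)) \<phi>" for \<phi> e x a
  proof -
    obtain n where n: "free_vars \<phi> \<subseteq> {..<n}"
      using finite_nat_bounded[OF finite_free_vars] by blast
    define as where "as = map e [0..<n]"
    have cong: "sat N (e(x := b)) \<phi> \<longleftrightarrow> sat N ((env as)(x := b)) \<phi>" for b
      by (rule sat_cong) (use n in \<open>auto simp: env_def as_def\<close>)
    have "sat N ((env as)(x := sk \<phi> x (env as))) \<phi>" using that cong sk by blast
    moreover have "sk \<phi> x (env as) \<in> S" using that by (intro sk_list) (auto simp: as_def)
    ultimately show ?thesis using cong by blast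
  qed
  let ?N = "N\<lparr>dom_of := S\<rparr>"
  have sel: "dom_of ?N = S" "fun_int ?N = fun_int N" "rel_int ?N = rel_int N" by simp_all
  have trm: "trm_val ?N e t = trm_val N e t" for e t
  proof (induction t)
    case (Fn f ts)
    then have "map (trm_val ?N e) ts = map (trm_val N e) ts" by simp
    then show ?case by (simp only: trm_val.simps sel)
  qed simp
  have elem: "sat ?N e \<phi> \<longleftrightarrow> sat N e \<phi>" if "is_formula L \<phi>" "range e \<subseteq> S" for \<phi> e
    using that
  proof (induction \<phi> arbitrary: e)
    case (Rel R ts)
    have "map (trm_val ?N e) ts = map (trm_val N e) ts" by (simp add: trm)
    then show ?case by (simp only: sat.simps sel)
  next
    case (Exists x \<phi>)
    have "sat ?N (e(x := a)) \<phi> \<longleftrightarrow> sat N (e(x := a)) \<phi>" if "a \<in> S" for a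
      using Exists.prems that by (intro Exists.IH) auto
    moreover have "(\<exists>a\<in>S. sat N (e(x := a)) \<phi>) \<longleftrightarrow> (\<exists>a\<in>dom_of N. sat N (e(x := a)) \<phi>)"
      using witness[of \<phi> e _ x] Exists.prems SN by (meson is_formula.simps(5) subsetD)
    ultimately show ?case unfolding sat.simps sel by blast
  qed (simp_all add: trm)
  have "is_structure L ?N"
    unfolding is_structure_def
  proof (intro conjI ballI allI impI)
    show "dom_of ?N \<noteq> {}" using dS by auto
    fix f as assume f: "f \<in> funs L" and as: "length as = fun_arity L f \<and> set as \<subseteq> dom_of ?N"
    let ?n = "length as"
    let ?\<phi> = "Eq (Var ?n) (Fn f (map Var [0..<?n])) :: ('f, 'r) fml"
    have val: "sat N ((env as)(?n := a)) ?\<phi> \<longleftrightarrow> a = fun_int N f as" for a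
    proof -
      have "map (trm_val N ((env as)(?n := a))) (map Var [0..<?n]) = as"
        by (rule nth_equalityI) (auto simp: env_def)
      then show ?thesis by (simp del: map_map)
    qed
    have "fun_int N f as \<in> dom_of N" using N f as SN unfolding is_structure_def by auto
    moreover have "range (env as) \<subseteq> S" using as dS by (auto simp: env_def)
    moreover have "is_formula L ?\<phi>" using f as by (simp add: list_all_iff)
    ultimately have "\<exists>a\<in>S. a = fun_int N f as"
      using witness[of ?\<phi> "env as" "fun_int N f as" ?n] val by blast
    then show "fun_int ?N f as \<in> dom_of ?N" by simp
  qed
  with AS SN card show ?thesis by (rule that) (simp add: elem)
qed

section \<open>Comparing the sets defined by two parameter tuples\<close>

definition solutions ::
  "('f, 'r, 'u) struct \<Rightarrow> ('f, 'r) fml \<Rightarrow> nat list \<Rightarrow> nat list \<Rightarrow> 'u list \<Rightarrow> 'u list set"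
where
  "solutions M \<phi> xs ys a = {b \<in> tuples M (length xs). sat M (assign (xs @ ys) (b @ a)) \<phi>}"

definition upd_list :: "(nat \<Rightarrow> 'u) \<Rightarrow> nat list \<Rightarrow> 'u list \<Rightarrow> nat \<Rightarrow> 'u" where
  "upd_list e vs as = (\<lambda>v. case map_of (zip vs as) v of None \<Rightarrow> e v | Some a \<Rightarrow> a)"

lemma upd_list_None: "map_of (zip vs as) v = None \<Longrightarrow> upd_list e vs as v = e v"
  by (simp only: upd_list_def option.case)

lemma upd_list_Some: "map_of (zip vs as) v = Some a \<Longrightarrow> upd_list e vs as v = a"
  by (simp only: upd_list_def option.case)

lemma upd_list_notin: "v \<notin> set vs \<Longrightarrow> length as = length vs \<Longrightarrow> upd_list e vs as v = e v"
  by (rule upd_list_None) simp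

lemma map_upd_list: "distinct vs \<Longrightarrow> length as = length vs \<Longrightarrow> map (upd_list e vs as) vs = as"
  by (rule nth_equalityI) (simp_all add: upd_list_Some map_of_zip_nth)

lemma upd_list_in:
  assumes "set as \<subseteq> D" "\<And>v. e v \<in> D"
  shows "upd_list e vs as v \<in> D"
proof (cases "map_of (zip vs as) v")
  case None
  then show ?thesis using assms by (simp only: upd_list_None)
next
  case (Some a)
  then have "a \<in> set as" by (meson map_of_SomeD set_zip_rightD)
  then show ?thesis using Some assms by (auto simp only: upd_list_Some)
qed

lemma sat_foldr_Exists:
  assumes "distinct vs"
  shows "sat M e (foldr Exists vs \<phi>) \<longleftrightarrow> (\<exists>as\<in>tuples M (length vs). sat M (upd_list e vs as) \<phi>)"
  using assms
proof (induction vs arbitrary: e)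
  case Nil
  have "tuples M 0 = {[]}" by (auto simp: tuples_def)
  then show ?case by (simp add: upd_list_def)
next
  case (Cons v vs)
  have upd: "upd_list (e(v := a)) vs as = upd_list e (v # vs) (a # as)"
    if "length as = length vs" for a as
  proof
    fix u
    show "upd_list (e(v := a)) vs as u = upd_list e (v # vs) (a # as) u"
    proof (cases "u = v")
      case True
      then have "upd_list (e(v := a)) vs as u = a"
        using upd_list_notin[of v vs as "e(v := a)"] Cons.prems that by simp
      then show ?thesis using True by (simp add: upd_list_def)
    next
      case False
      then have "map_of (zip (v # vs) (a # as)) u = map_of (zip vs as) u" "(e(v := a)) u = e u"
        by simp_all
      then show ?thesis unfolding upd_list_def by presburger
    qed
  qed
  have tup: "tuples M (length (v # vs)) = (\<lambda>(a, as). a # as) ` (dom_of M \<times> tuples M (length vs))"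
    by (auto simp: tuples_def length_Suc_conv image_iff)
  have "sat M e (foldr Exists (v # vs) \<phi>) \<longleftrightarrow>
      (\<exists>a\<in>dom_of M. \<exists>as\<in>tuples M (length vs). sat M (upd_list (e(v := a)) vs as) \<phi>)"
    using Cons by simp
  also have "\<dots> \<longleftrightarrow> (\<exists>a\<in>dom_of M. \<exists>as\<in>tuples M (length vs). sat M (upd_list e (v # vs) (a # as)) \<phi>)"
    using upd by (intro bex_cong refl) (simp add: tuples_def)
  also have "\<dots> \<longleftrightarrow> (\<exists>as\<in>tuples M (length (v # vs)). sat M (upd_list e (v # vs) as) \<phi>)"
    unfolding tup by auto
  finally show ?case .
qed

lemma sat_foldr_Eq:
  "sat M e (foldr (\<lambda>y. Conj (Eq (Var y) (Var (y + k)))) ys \<phi>) \<longleftrightarrow>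
    (\<forall>y\<in>set ys. e y = e (y + k)) \<and> sat M e \<phi>"
  by (induction ys) auto

text \<open>
  This formula says \<open>\<exists>x. \<not> \<phi>(x; y) \<and> \<phi>(x; y')\<close>, where \<open>y'\<close> consists of the variables \<open>y + k\<close>.
  Instead of substituting \<open>y'\<close> for \<open>y\<close>, which would require renaming bound variables, the second
  part is written as \<open>\<exists>y. y = y' \<and> \<phi>(x; y)\<close>. This is correct as soon as \<open>k\<close> exceeds all variables in
  \<open>xs\<close> and \<open>ys\<close>.
\<close>

definition not_included :: "nat \<Rightarrow> ('f, 'r) fml \<Rightarrow> nat list \<Rightarrow> nat list \<Rightarrow> ('f, 'r) fml" where
  "not_included k \<phi> xs ys =
    foldr Exists xs (Conj (Neg \<phi>)
      (foldr Exists ys (foldr (\<lambda>y. Conj (Eq (Var y) (Var (y + k)))) ys \<phi>)))"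

lemma is_formula_not_included: "is_formula L \<phi> \<Longrightarrow> is_formula L (not_included k \<phi> xs ys)"
proof -
  assume \<phi>: "is_formula L \<phi>"
  have "is_formula L \<psi> \<Longrightarrow> is_formula L (foldr Exists vs \<psi>)" for \<psi> :: "('a, 'b) fml" and vs
    by (induction vs) auto
  moreover have "is_formula L (foldr (\<lambda>y. Conj (Eq (Var y) (Var (y + k)))) vs \<phi>)" for vs
    using \<phi> by (induction vs) auto
  ultimately show ?thesis unfolding not_included_def using \<phi> by simp
qed

lemma sat_not_included:
  assumes dist: "distinct (xs @ ys)" and fv: "free_vars \<phi> \<subseteq> set (xs @ ys)"
    and k: "\<And>v. v \<in> set (xs @ ys) \<Longrightarrow> v < k" and e: "range e \<subseteq> dom_of M"
  shows "sat M e (not_included k \<phi> xs ys) \<longleftrightarrow>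
    \<not> solutions M \<phi> xs ys (map (\<lambda>y. e (y + k)) ys) \<subseteq> solutions M \<phi> xs ys (map e ys)"
proof -
  have agree: "sat M (upd_list (upd_list e' xs c) ys d) \<phi> \<longleftrightarrow> sat M (assign (xs @ ys) (c @ d)) \<phi>"
    if len: "length c = length xs" "length d = length ys" for c d e'
  proof (rule sat_cong)
    fix v assume "v \<in> free_vars \<phi>"
    then consider "v \<in> set xs" "v \<notin> set ys" | "v \<in> set ys" "v \<notin> set xs" using fv dist by auto
    then show "upd_list (upd_list e' xs c) ys d v = assign (xs @ ys) (c @ d) v"
    proof cases
      case 1
      then obtain a where "map_of (zip xs c) v = Some a"
        using len map_of_zip_is_Some[of xs c v] by auto
      moreover have "map_of (zip ys d) v = None" using 1 len by simp
      ultimately show ?thesis using len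
        by (simp add: upd_list_None upd_list_Some assign_def map_add_def del: map_of_eq_None_iff)
    next
      case 2
      then obtain a where "map_of (zip ys d) v = Some a"
        using len map_of_zip_is_Some[of ys d v] by auto
      moreover have "map_of (zip xs c) v = None" using 2 len by simp
      ultimately show ?thesis using len
        by (simp add: upd_list_Some assign_def map_add_dom_app_simps(3) domIff del: map_of_eq_None_iff)
    qed
  qed
  have inner: "sat M (upd_list e xs c) \<phi> \<longleftrightarrow> sat M (assign (xs @ ys) (c @ map e ys)) \<phi>"
    if c: "length c = length xs" for c
  proof -
    have "upd_list (upd_list e xs c) ys (map e ys) v = upd_list e xs c v" for v
    proof (cases "v \<in> set ys")
      case True
      then have "upd_list e xs c v = e v" using dist c by (intro upd_list_notin) auto
      then show ?thesis using True by (simp add: upd_list_Some map_of_zip_map)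
    next
      case False
      then show ?thesis by (intro upd_list_notin) auto
    qed
    then have "upd_list (upd_list e xs c) ys (map e ys) = upd_list e xs c" by (rule ext)
    then show ?thesis using agree[of c "map e ys" e] c by simp
  qed
  let ?b = "map (\<lambda>y. e (y + k)) ys"
  have b: "?b \<in> tuples M (length ys)" using e by (auto simp: tuples_def)
  have copy: "(\<forall>y\<in>set ys. upd_list (upd_list e xs c) ys d y = upd_list (upd_list e xs c) ys d (y + k))
      \<longleftrightarrow> d = ?b"
    if c: "length c = length xs" and d: "length d = length ys" for c d
  proof -
    have "y + k \<notin> set (xs @ ys)" for y using k[of "y + k"] by auto
    then have "upd_list (upd_list e xs c) ys d (y + k) = e (y + k)" for y
      using c d by (simp add: upd_list_notin)
    moreover have "(\<forall>y\<in>set ys. upd_list (upd_list e xs c) ys d y = e (y + k)) \<longleftrightarrow>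
        map (upd_list (upd_list e xs c) ys d) ys = ?b"
      by (simp add: list_eq_iff_nth_eq all_set_conv_all_nth)
    moreover have "map (upd_list (upd_list e xs c) ys d) ys = d"
      using dist d by (intro map_upd_list) auto
    ultimately show ?thesis by simp
  qed
  have "sat M (upd_list e xs c) (foldr Exists ys (foldr (\<lambda>y. Conj (Eq (Var y) (Var (y + k)))) ys \<phi>)) \<longleftrightarrow>
      sat M (assign (xs @ ys) (c @ ?b)) \<phi>" if c: "length c = length xs" for c
  proof -
    have "sat M (upd_list e xs c) (foldr Exists ys (foldr (\<lambda>y. Conj (Eq (Var y) (Var (y + k)))) ys \<phi>)) \<longleftrightarrow>
        (\<exists>d\<in>tuples M (length ys). d = ?b \<and> sat M (assign (xs @ ys) (c @ d)) \<phi>)"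
      using dist copy[OF c] agree[OF c, of _ e]
      by (auto simp add: sat_foldr_Exists sat_foldr_Eq tuples_def)
    then show ?thesis using b by auto
  qed
  then have "sat M e (not_included k \<phi> xs ys) \<longleftrightarrow>
      (\<exists>c\<in>tuples M (length xs). \<not> sat M (assign (xs @ ys) (c @ map e ys)) \<phi> \<and>
        sat M (assign (xs @ ys) (c @ ?b)) \<phi>)"
    unfolding not_included_def using dist inner by (auto simp: sat_foldr_Exists tuples_def)
  then show ?thesis unfolding solutions_def by auto
qed

section \<open>Chains of definable sets\<close>

text \<open>
  The conclusion is the clause of the strict order property for \<open>s\<close> in place of a finite order:
  the parameters \<open>b i\<close> define sets that increase strictly along \<open>s\<close>.
\<close>

lemma SOP_chain_of_definable_sets:
  fixes L :: "('f, 'r) signature" and s :: "'s rel"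
  assumes L: "countable_signature L" and T: "is_theory L T"
    and SOP: "formula_has_SOP TYPE('u) L T \<phi> xs ys"
    and \<kappa>: "Cinfinite \<kappa>" and M: "universal_model L T \<kappa> (M :: ('f, 'r, 'u) struct)"
    and s: "Linear_order s" "|Field s| \<le>o \<kappa>"
  obtains b where "\<forall>i\<in>Field s. b i \<in> tuples M (length ys)"
    "\<forall>i\<in>Field s. \<forall>j\<in>Field s.
      \<not> solutions M \<phi> xs ys (b j) \<subseteq> solutions M \<phi> xs ys (b i) \<longleftrightarrow> (i, j) \<in> s \<and> i \<noteq> j"
proof -
  have \<phi>: "is_formula L \<phi>" and dist: "distinct (xs @ ys)" and fv: "free_vars \<phi> \<subseteq> set (xs @ ys)"
    using SOP unfolding formula_has_SOP_def by blast+
  have eq: "(\<exists>b\<in>tuples M (length xs). \<not> sat M (assign (xs @ ys) (b @ a)) \<phi> \<and>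
        sat M (assign (xs @ ys) (b @ a')) \<phi>) \<longleftrightarrow>
      \<not> solutions M \<phi> xs ys a' \<subseteq> solutions M \<phi> xs ys a" for M :: "('f, 'r, 'u) struct" and a a'
    unfolding solutions_def by auto
  have ex: "\<forall>n::nat. \<exists>(M :: ('f, 'r, 'u) struct) a. is_model L T M \<and> (\<forall>l<n. a l \<in> tuples M (length ys)) \<and>
      (\<forall>k<n. \<forall>l<n. \<not> solutions M \<phi> xs ys (a l) \<subseteq> solutions M \<phi> xs ys (a k) \<longleftrightarrow> k < l)"
    using SOP unfolding formula_has_SOP_def eq by (elim conjE)
  obtain Mod :: "nat \<Rightarrow> ('f, 'r, 'u) struct" where
    Mod: "\<forall>n. \<exists>a. is_model L T (Mod n) \<and> (\<forall>l<n. a l \<in> tuples (Mod n) (length ys)) \<and>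
      (\<forall>k<n. \<forall>l<n. \<not> solutions (Mod n) \<phi> xs ys (a l) \<subseteq> solutions (Mod n) \<phi> xs ys (a k) \<longleftrightarrow> k < l)"
    by (rule choice[OF ex, THEN exE])
  obtain par where
    P: "\<forall>n. is_model L T (Mod n) \<and> (\<forall>l<n. par n l \<in> tuples (Mod n) (length ys)) \<and>
      (\<forall>k<n. \<forall>l<n. \<not> solutions (Mod n) \<phi> xs ys (par n l) \<subseteq> solutions (Mod n) \<phi> xs ys (par n k) \<longleftrightarrow> k < l)"
    by (rule choice[OF Mod, THEN exE])
  have s_trans: "trans s" and s_anti: "antisym s" and s_total: "total_on (Field s) s"
    using s(1) by (simp_all add: order_on_defs)
  (* For a finite subset X of s, the chain of length card X is indexed by X through the rank
     pos X i of i in X. *)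
  define K where "K = (\<lambda>X :: 's set. Mod (card X))"
  define pos where "pos = (\<lambda>X i. card {j \<in> X. (j, i) \<in> s \<and> j \<noteq> i})"
  have K: "is_model L T (K X)" for X using P by (simp add: K_def)
  then have K_ne: "dom_of (K X) \<noteq> {}" for X by (auto simp: is_model_def is_structure_def)

  have pos_card: "pos X i < card X" if "finite X" "i \<in> X" for X i
    unfolding pos_def using that by (intro psubset_card_mono) auto
  have pos_mono: "pos X i < pos X j" if "finite X" "i \<in> X" "(i, j) \<in> s" "i \<noteq> j" for X i j
    unfolding pos_def
  proof (rule psubset_card_mono)
    have "(l, j) \<in> s \<and> l \<noteq> j" if "(l, i) \<in> s" "l \<noteq> i" for l
      using that \<open>(i, j) \<in> s\<close> \<open>i \<noteq> j\<close> transD[OF s_trans] antisymD[OF s_anti] by metis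
    then show "{l \<in> X. (l, i) \<in> s \<and> l \<noteq> i} \<subset> {l \<in> X. (l, j) \<in> s \<and> l \<noteq> j}"
      using \<open>i \<in> X\<close> \<open>(i, j) \<in> s\<close> \<open>i \<noteq> j\<close> by blast
  qed (use that in simp)
  have pos_less: "pos X i < pos X j \<longleftrightarrow> (i, j) \<in> s \<and> i \<noteq> j"
    if X: "finite X" "X \<subseteq> Field s" "i \<in> X" "j \<in> X" for X i j
  proof (cases "i = j")
    case False
    then have "(i, j) \<in> s \<or> (j, i) \<in> s"
      using X s_total unfolding total_on_def by blast
    moreover have "\<not> ((i, j) \<in> s \<and> (j, i) \<in> s)"
      using False antisymD[OF s_anti] by blast
    ultimately show ?thesis
      using False pos_mono[of X i j] pos_mono[of X j i] X by auto
  qed simp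

  (* Parameter tuples are extended to total assignments: the variables below k of one assignment
     and a copy of another one shifted by k then form an assignment for not_included. If X is
     infinite or does not contain i, the assignment is an arbitrary default. *)
  have "\<exists>w. range w \<subseteq> dom_of (K X) \<and> (finite X \<and> i \<in> X \<longrightarrow> map w ys = par (card X) (pos X i))"
    for X i
  proof -
    obtain d where d: "d \<in> dom_of (K X)" using K_ne by blast
    show ?thesis
    proof (cases "finite X \<and> i \<in> X")
      case True
      let ?a = "par (card X) (pos X i)"
      have a: "?a \<in> tuples (K X) (length ys)" using P pos_card True unfolding K_def by blast
      then have "range (upd_list (\<lambda>_. d) ys ?a) \<subseteq> dom_of (K X)"
        using d by (auto simp: tuples_def intro!: upd_list_in)
      moreover have "map (upd_list (\<lambda>_. d) ys ?a) ys = ?a"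
        using a dist by (intro map_upd_list) (auto simp: tuples_def)
      ultimately show ?thesis by blast
    next
      case False
      then show ?thesis using d by (intro exI[of _ "\<lambda>_. d"]) auto
    qed
  qed
  then have "\<forall>X. \<exists>w. \<forall>i. range (w i) \<subseteq> dom_of (K X) \<and>
      (finite X \<and> i \<in> X \<longrightarrow> map (w i) ys = par (card X) (pos X i))"
    by (intro allI choice) blast
  then obtain w where w: "\<forall>X i. range (w X i) \<subseteq> dom_of (K X) \<and>
      (finite X \<and> i \<in> X \<longrightarrow> map (w X i) ys = par (card X) (pos X i))"
    by (rule choice[THEN exE])
  have w_dom: "w X i v \<in> dom_of (K X)" for X i v using w by blast
  have w_sol: "\<not> solutions (K X) \<phi> xs ys (map (w X j) ys) \<subseteq> solutions (K X) \<phi> xs ys (map (w X i) ys)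
      \<longleftrightarrow> (i, j) \<in> s \<and> i \<noteq> j"
    if X: "finite X" "X \<subseteq> Field s" "i \<in> X" "j \<in> X" for X i j
  proof -
    have "map (w X i) ys = par (card X) (pos X i)" "map (w X j) ys = par (card X) (pos X j)"
      using w X by simp_all
    then show ?thesis using P pos_card[of X] X pos_less[OF X] by (simp add: K_def)
  qed

  obtain k where "set (xs @ ys) \<subseteq> {..<k}" using finite_nat_bounded[of "set (xs @ ys)"] by blast
  then have k: "v < k" if "v \<in> set (xs @ ys)" for v using that by blast
  define \<chi> where "\<chi> = not_included k \<phi> xs ys"
  have \<chi>: "is_formula L \<chi>" using \<phi> by (simp add: \<chi>_def is_formula_not_included)

  obtain U where U: "U \<le> finite_subsets_at_top (Field s)" "U \<noteq> bot"
    "\<forall>P. eventually P U \<or> eventually (\<lambda>i. \<not> P i) U"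
    using ultrafilter_below[OF finite_subsets_at_top_neq_bot] .
  define N where "N = ultraproduct U K"
  have N: "is_model L T N" unfolding N_def by (rule is_model_ultraproduct[OF U(2,3) K])
  define c where "c = (\<lambda>i v. ultra_rep U (\<lambda>X. w X i v))"
  define e where "e = (\<lambda>i j v. if v < k then c i v else c j (v - k))"
  have c_dom: "c i v \<in> dom_of N" for i v
    unfolding N_def ultraproduct_sel c_def using w_dom by (intro imageI) simp
  have sat_N: "sat N (e i j) \<chi> \<longleftrightarrow> (i, j) \<in> s \<and> i \<noteq> j" if ij: "i \<in> Field s" "j \<in> Field s" for i j
  proof -
    let ?e = "\<lambda>X v. if v < k then w X i v else w X j (v - k)"
    have "eventually (\<lambda>X. finite X \<and> {i, j} \<subseteq> X \<and> X \<subseteq> Field s) (finite_subsets_at_top (Field s))"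
      using ij unfolding eventually_finite_subsets_at_top by (intro exI[of _ "{i, j}"]) auto
    then have "eventually (\<lambda>X. finite X \<and> {i, j} \<subseteq> X \<and> X \<subseteq> Field s) U"
      using U(1) by (rule filter_leD[rotated])
    then have ev: "\<forall>\<^sub>F X in U. sat (K X) (?e X) \<chi> \<longleftrightarrow> (i, j) \<in> s \<and> i \<noteq> j"
    proof (rule eventually_mono)
      fix X assume X: "finite X \<and> {i, j} \<subseteq> X \<and> X \<subseteq> Field s"
      have i: "map (?e X) ys = map (w X i) ys" using k by simp
      have j: "map (\<lambda>y. ?e X (y + k)) ys = map (w X j) ys" by simp
      have e: "range (?e X) \<subseteq> dom_of (K X)" using w_dom by auto
      have "sat (K X) (?e X) \<chi> \<longleftrightarrow>
          \<not> solutions (K X) \<phi> xs ys (map (w X j) ys) \<subseteq> solutions (K X) \<phi> xs ys (map (w X i) ys)"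
        using sat_not_included[OF dist fv k e] by (simp only: \<chi>_def i j)
      also have "\<dots> \<longleftrightarrow> (i, j) \<in> s \<and> i \<noteq> j" by (rule w_sol) (use X in auto)
      finally show "sat (K X) (?e X) \<chi> \<longleftrightarrow> (i, j) \<in> s \<and> i \<noteq> j" .
    qed
    have "e i j = (\<lambda>v. ultra_rep U (\<lambda>X. ?e X v))" by (auto simp: e_def c_def)
    then have "sat N (e i j) \<chi> \<longleftrightarrow> (\<forall>\<^sub>F X in U. sat (K X) (?e X) \<chi>)"
      unfolding N_def using sat_ultraproduct[OF U(2,3) K_ne, where e = "\<lambda>v X. ?e X v" and \<phi> = \<chi>] by (simp only:)
    also have "\<dots> \<longleftrightarrow> (\<forall>\<^sub>F X in U. (i, j) \<in> s \<and> i \<noteq> j)" by (rule eventually_subst[OF ev])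
    also have "\<dots> \<longleftrightarrow> (i, j) \<in> s \<and> i \<noteq> j" using U(2) by (simp add: eventually_const)
    finally show ?thesis .
  qed

  (* All values of the assignments c i are kept, not only those at ys, so that the assignments
     e i j remain inside the submodel. *)
  define A where "A = (\<lambda>(i, v). c i v) ` (Field s \<times> UNIV)"
  have "|Field s \<times> (UNIV :: nat set)| \<le>o \<kappa>"
    using \<kappa> s(2) countable_card_le[OF \<kappa>, of "UNIV :: nat set"]
    by (intro card_of_Times_ordLeq_infinite_Field) (auto simp: cinfinite_def)
  then have A_card: "|A| \<le>o \<kappa>" unfolding A_def using card_of_image ordLeq_transitive by blast
  have A_dom: "A \<subseteq> dom_of N" unfolding A_def using c_dom by auto
  have N_str: "is_structure L N" using N by (simp add: is_model_def)
  obtain S where S: "A \<subseteq> S" "S \<subseteq> dom_of N" "|S| \<le>o \<kappa>" "is_structure L (N\<lparr>dom_of := S\<rparr>)"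
    "\<forall>\<phi> e. is_formula L \<phi> \<longrightarrow> range e \<subseteq> S \<longrightarrow> (sat (N\<lparr>dom_of := S\<rparr>) e \<phi> \<longleftrightarrow> sat N e \<phi>)"
    using downward_Loewenheim_Skolem[OF L \<kappa> N_str A_dom A_card] .
  let ?N = "N\<lparr>dom_of := S\<rparr>"
  have "sat ?N e \<psi>" if "\<psi> \<in> T" "range e \<subseteq> S" for \<psi> e
  proof -
    have "is_formula L \<psi>" using T that(1) by (simp add: is_theory_def)
    moreover have "range e \<subseteq> dom_of N" using that(2) S(2) by (rule order_trans)
    then have "sat N e \<psi>" using N that(1) by (simp add: is_model_def)
    ultimately show ?thesis using S(5) that(2) by simp
  qed
  then have "is_model L T ?N" using S(4) by (simp add: is_model_def)
  then obtain h where h: "elementary_embedding L ?N M h"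
    using universal_model_any_type[OF _ T M, of ?N] \<kappa> S(3) by auto
  define b where "b = (\<lambda>i. map (\<lambda>y. h (c i y)) ys)"
  have cS: "c i v \<in> S" if "i \<in> Field s" for i v using S(1) that unfolding A_def by auto
  have h_dom: "h a \<in> dom_of M" if "a \<in> S" for a
    using h that unfolding elementary_embedding_def by auto
  have "b i \<in> tuples M (length ys)" if "i \<in> Field s" for i
    using cS[OF that] h_dom by (auto simp: b_def tuples_def)
  moreover have "\<not> solutions M \<phi> xs ys (b j) \<subseteq> solutions M \<phi> xs ys (b i) \<longleftrightarrow> (i, j) \<in> s \<and> i \<noteq> j"
    if ij: "i \<in> Field s" "j \<in> Field s" for i j
  proof -
    have eS: "range (e i j) \<subseteq> S" using cS ij by (auto simp: e_def)
    then have dom: "range (h \<circ> e i j) \<subseteq> dom_of M" using h_dom by auto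
    have "sat M (h \<circ> e i j) \<chi> \<longleftrightarrow> sat ?N (e i j) \<chi>"
      using h \<chi> eS unfolding elementary_embedding_def by simp
    also have "\<dots> \<longleftrightarrow> (i, j) \<in> s \<and> i \<noteq> j" using S(5) \<chi> eS sat_N[OF ij] by simp
    finally have "sat M (h \<circ> e i j) \<chi> \<longleftrightarrow> (i, j) \<in> s \<and> i \<noteq> j" .
    moreover have "map (h \<circ> e i j) ys = b i" using k by (simp add: b_def e_def)
    moreover have "map (\<lambda>y. (h \<circ> e i j) (y + k)) ys = b j" by (simp add: b_def e_def)
    ultimately show ?thesis
      using sat_not_included[OF dist fv k dom] unfolding \<chi>_def by simp
  qed
  ultimately show ?thesis by (intro that[of b]) auto
qed

section \<open>The universal linear order\<close>

theorem mainTheorem17: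
  fixes L :: "('f, 'r) signature" and T :: "('f, 'r) fml set" and \<kappa> :: "'u rel"
  assumes "countable_signature L" and "is_theory L T"
    and "has_SOP TYPE('u) L T"
    and "cinfinite \<kappa>" and "Card_order \<kappa>"
    and "\<exists>M :: ('f, 'r, 'u) struct. universal_model L T \<kappa> M"
  shows "\<exists>r :: 'u rel. universal_linear_order \<kappa> r"
proof -
  have \<kappa>: "Cinfinite \<kappa>" using assms(4,5) by simp
  obtain \<phi> xs ys where SOP: "formula_has_SOP TYPE('u) L T \<phi> xs ys"
    using assms(3) unfolding has_SOP_def by blast
  obtain M :: "('f, 'r, 'u) struct" where M: "universal_model L T \<kappa> M" using assms(6) by blast
  let ?sol = "solutions M \<phi> xs ys"
  define G where "G = ?sol ` tuples M (length ys)"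
  have "|dom_of M| \<le>o \<kappa>" using M by (simp add: universal_model_def ordIso_imp_ordLeq)
  then have "|tuples M (length ys)| \<le>o \<kappa>"
    unfolding tuples_def by (rule card_of_lists_length_le[OF \<kappa>])
  then have G_card: "|G| \<le>o \<kappa>" unfolding G_def using card_of_image ordLeq_transitive by blast
  obtain r0 where r0: "Linear_order r0" "Field r0 = G"
    "\<forall>A\<in>G. \<forall>B\<in>G. A \<subseteq> B \<longrightarrow> (A, B) \<in> r0"
    using linear_order_extending_inclusion[of G] .
  obtain g :: "'u list set \<Rightarrow> 'u" where g: "inj_on g G"
    using inj_into_type_of_cardinal[OF assms(5) G_card] .
  define r where "r = dir_image r0 g"
  have r_lin: "Linear_order r" unfolding r_def using r0(1,2) g by (simp add: Linear_order_dir_image)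
  have r_Field: "Field r = g ` G" unfolding r_def by (simp add: dir_image_Field r0(2))
  have univ: "\<exists>f. inj_on f (Field s) \<and> compat s r f"
    if s: "Linear_order s" "|Field s| \<le>o \<kappa>" for s :: "'u rel"
  proof -
    have s_anti: "antisym s" and s_total: "total_on (Field s) s"
      using s(1) by (simp_all add: order_on_defs)
    obtain b where b0: "\<forall>i\<in>Field s. b i \<in> tuples M (length ys)"
      "\<forall>i\<in>Field s. \<forall>j\<in>Field s. \<not> ?sol (b j) \<subseteq> ?sol (b i) \<longleftrightarrow> (i, j) \<in> s \<and> i \<noteq> j"
      using SOP_chain_of_definable_sets[OF assms(1,2) SOP \<kappa> M s] .
    note b = b0[rule_format]
    have bG: "?sol (b i) \<in> G" if "i \<in> Field s" for i using b(1)[OF that] by (simp add: G_def)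
    have "inj_on (\<lambda>i. ?sol (b i)) (Field s)"
    proof (rule inj_onI, rule ccontr)
      fix i j assume ij: "i \<in> Field s" "j \<in> Field s" "?sol (b i) = ?sol (b j)" "i \<noteq> j"
      then have "(i, j) \<in> s \<or> (j, i) \<in> s" using s_total unfolding total_on_def by blast
      then show False using b(2)[of i j] b(2)[of j i] ij by auto
    qed
    then have "inj_on (\<lambda>i. g (?sol (b i))) (Field s)"
      using g bG unfolding inj_on_def by blast
    moreover have "(g (?sol (b i)), g (?sol (b j))) \<in> r" if ij: "(i, j) \<in> s" for i j
    proof -
      have F: "i \<in> Field s" "j \<in> Field s" using ij by (auto simp: Field_def)
      have "\<not> ((j, i) \<in> s \<and> j \<noteq> i)" using ij antisymD[OF s_anti] by blast
      then have "?sol (b i) \<subseteq> ?sol (b j)" using b(2)[OF F(2,1)] by blast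
      then have "(?sol (b i), ?sol (b j)) \<in> r0" using r0(3) bG F by blast
      then show ?thesis unfolding r_def dir_image_def by blast
    qed
    ultimately show ?thesis unfolding compat_def by blast
  qed
  have "|Field r| \<le>o \<kappa>"
    unfolding r_Field using card_of_image G_card ordLeq_transitive by blast
  moreover have "\<kappa> \<le>o |Field r|"
  proof -
    have iso: "|Field \<kappa>| =o \<kappa>" using assms(5) by (rule card_of_Field_ordIso)
    moreover have lin: "Linear_order \<kappa>" using assms(5) by (simp add: card_order_on_def order_on_defs)
    ultimately obtain f where f: "inj_on f (Field \<kappa>)" "compat \<kappa> r f"
      using univ ordIso_imp_ordLeq by blast
    have "f i \<in> Field r" if "i \<in> Field \<kappa>" for i
    proof -
      have "(i, i) \<in> \<kappa>" using lin that by (simp add: order_on_defs refl_on_def)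
      then have "(f i, f i) \<in> r" using f(2) unfolding compat_def by blast
      then show ?thesis by (auto simp: Field_def)
    qed
    then have "|Field \<kappa>| \<le>o |Field r|" using f(1) card_of_ordLeq by blast
    then show ?thesis using iso ordIso_symmetric ordIso_ordLeq_trans by blast
  qed
  ultimately have "|Field r| =o \<kappa>" by (simp add: ordIso_iff_ordLeq)
  then show ?thesis using r_lin univ unfolding universal_linear_order_def by blast
qed

end
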